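(* If $n\le d+3$, then every $d$-dimensional CF-tree on $[n]$ has a free maximal subcircuit and is chordal.
   Context: Let $[n]=\{1,\ldots,n\}$ and let $d\ge 0$ be an integer. A $d$-clutter on $[n]$ is a (possibly empty) family $\mathcal{C}$ of $(d+1)$-subsets of $[n]$, called circuits. A maximal subcircuit (MS) of $\mathcal{C}$ is a $d$-subset of $[n]$ contained in some circuit; $\mathcal{MS}(\mathcal{C})$ is the set of them; $\deg(e)$ is the number of circuits containing $e$. An MS $e$ is free if $\deg(e)=1$. For $e\subseteq[n]$, $\mathcal{C}-e$ is the family of circuits that do not contain $e$. A set $L\subseteq[n]$ is a clique in $\mathcal{C}$ if every $(d+1)$-subset of $L$ is in $\mathcal{C}$. For an MS $e$, $\mathrm{N}[e]=e\cup\{v\in[n]: e\cup\{v\}\in\mathcal{C}\}$; $e$ is simplicial if $\mathrm{N}[e]$ is a clique. $\mathcal{C}$ is chordal if it is empty or there is a sequence $e_1,\ldots,e_t$ such that $e_i$ is a simplicial maximal subcircuit of $\mathcal{C}-e_1-\cdots-e_{i-1}$ for each $i$ and $\mathcal{C}-e_1-\cdots-e_t=\emptyset$. A $d$-clutter is strongly connected if for any two circuits $F_1,F_2$ there is a sequence of circuits starting with $F_1$ and ending with $F_2$ in which consecutive circuits share a common MS. A $d$-dimensional CF-cycle is a nonempty strongly connected $d$-clutter in which $\deg(e)$ is even for each MS $e$. A $d$-dimensional CF-tree is a nonempty $d$-clutter that contains no CF-cycle as a subfamily. *)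

theory Defs
  imports Main
begin

definition clutter :: "nat \<Rightarrow> nat \<Rightarrow> nat set set \<Rightarrow> bool" where
  "clutter n d C \<longleftrightarrow> (\<forall>F\<in>C. F \<subseteq> {1..n} \<and> card F = d + 1)"

definition max_subcircuits :: "nat \<Rightarrow> nat \<Rightarrow> nat set set \<Rightarrow> nat set set" where
  "max_subcircuits n d C = {e. e \<subseteq> {1..n} \<and> card e = d \<and> (\<exists>F\<in>C. e \<subseteq> F)}"

definition deg :: "nat set set \<Rightarrow> nat set \<Rightarrow> nat" where
  "deg C e = card {F \<in> C. e \<subseteq> F}"

definition free_max_subcircuit :: "nat \<Rightarrow> nat \<Rightarrow> nat set set \<Rightarrow> nat set \<Rightarrow> bool" where
  "free_max_subcircuit n d C e \<longleftrightarrow> e \<in> max_subcircuits n d C \<and> deg C e = 1"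

definition deletion :: "nat set set \<Rightarrow> nat set \<Rightarrow> nat set set" where
  "deletion C e = {F \<in> C. \<not> e \<subseteq> F}"

definition clique :: "nat \<Rightarrow> nat \<Rightarrow> nat set set \<Rightarrow> nat set \<Rightarrow> bool" where
  "clique n d C L \<longleftrightarrow> L \<subseteq> {1..n} \<and> (\<forall>F. F \<subseteq> L \<and> card F = d + 1 \<longrightarrow> F \<in> C)"

definition closed_nbhd :: "nat \<Rightarrow> nat set set \<Rightarrow> nat set \<Rightarrow> nat set" where
  "closed_nbhd n C e = e \<union> {v \<in> {1..n}. e \<union> {v} \<in> C}"

definition simplicial :: "nat \<Rightarrow> nat \<Rightarrow> nat set set \<Rightarrow> nat set \<Rightarrow> bool" where
  "simplicial n d C e \<longleftrightarrow> e \<in> max_subcircuits n d C \<and> clique n d C (closed_nbhd n C e)"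

(* foldl deletion C [e1, ..., et] is C - e1 - ... - et; list positions count from 0. *)
definition chordal :: "nat \<Rightarrow> nat \<Rightarrow> nat set set \<Rightarrow> bool" where
  "chordal n d C \<longleftrightarrow> C = {} \<or>
     (\<exists>es. (\<forall>i<length es. simplicial n d (foldl deletion C (take i es)) (es ! i)) \<and>
           foldl deletion C es = {})"

definition strongly_connected :: "nat \<Rightarrow> nat \<Rightarrow> nat set set \<Rightarrow> bool" where
  "strongly_connected n d C \<longleftrightarrow>
     (\<forall>F1\<in>C. \<forall>F2\<in>C. \<exists>Fs. Fs \<noteq> [] \<and> set Fs \<subseteq> C \<and> hd Fs = F1 \<and> last Fs = F2 \<and>
        (\<forall>i. Suc i < length Fs \<longrightarrow>
           (\<exists>e\<in>max_subcircuits n d C. e \<subseteq> Fs ! i \<and> e \<subseteq> Fs ! Suc i)))"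

definition CF_cycle :: "nat \<Rightarrow> nat \<Rightarrow> nat set set \<Rightarrow> bool" where
  "CF_cycle n d C \<longleftrightarrow> clutter n d C \<and> C \<noteq> {} \<and> strongly_connected n d C \<and>
     (\<forall>e\<in>max_subcircuits n d C. even (deg C e))"

definition CF_tree :: "nat \<Rightarrow> nat \<Rightarrow> nat set set \<Rightarrow> bool" where
  "CF_tree n d C \<longleftrightarrow> clutter n d C \<and> C \<noteq> {} \<and> \<not> (\<exists>C'\<subseteq>C. CF_cycle n d C')"

end

theory Submission
  imports Defs
begin

text \<open>
  A clutter on \<open>[n]\<close> with \<open>n \<le> d + 3\<close> is also a clutter on \<open>V = [d + 3]\<close>, where circuits are the
  complements of the edges of a graph \<open>G\<close>, and a \<open>d\<close>-set is the complement of a triple, its degree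
  being the number of edges of \<open>G\<close> in that triple. If no triple contains exactly one edge, then
  non-adjacency is an equivalence relation, so if \<open>G\<close> has an edge \<open>ab\<close>, it contains all pairs between
  the class \<open>A\<close> of \<open>a\<close> and \<open>V - A\<close>. A triple meets such a cut in \<open>k (3 - k)\<close> pairs, an even number,
  so the cut is a CF-cycle. Hence a CF-tree has a free maximal subcircuit. Free maximal subcircuits
  are simplicial, and deleting one leaves a CF-tree or the empty clutter.
\<close>

lemma clutter_mono: "clutter n d C \<Longrightarrow> C' \<subseteq> C \<Longrightarrow> clutter n d C'"
  by (auto simp: clutter_def)

lemma finite_clutter:
  assumes "clutter n d C"
  shows "finite C"
proof (rule finite_subset)
  show "C \<subseteq> Pow {1..n}"
    using assms by (auto simp: clutter_def)
qed simp

text \<open>The bound by \<open>{1..n}\<close> is inherited from the circuits; without it,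
  \<open>d\<close>-sets can be handled inside another ground set \<open>V\<close>.\<close>

lemma max_subcircuits_eq:
  assumes "clutter n d C"
  shows "max_subcircuits n d C = {e. card e = d \<and> (\<exists>F\<in>C. e \<subseteq> F)}"
  using assms unfolding max_subcircuits_def clutter_def by blast

lemma CF_tree_mono:
  assumes "CF_tree n d C" "C' \<subseteq> C" "C' \<noteq> {}"
  shows "CF_tree n d C'"
  using assms clutter_mono[of n d C C'] unfolding CF_tree_def by blast

text \<open>The closed neighbourhood of \<open>e\<close> stays inside the only circuit that contains
  \<open>e\<close>, and a circuit is a clique, being its own only subset of size
  \<open>d + 1\<close>.\<close>

lemma free_imp_simplicial:
  assumes C: "clutter n d C" and e: "free_max_subcircuit n d C e"
  shows "simplicial n d C e"
proof -
  have ms: "e \<in> max_subcircuits n d C" and "card {F \<in> C. e \<subseteq> F} = 1"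
    using e by (auto simp: free_max_subcircuit_def deg_def)
  then obtain F where F: "{F \<in> C. e \<subseteq> F} = {F}"
    by (auto simp: card_1_singleton_iff)
  then have "F \<in> C" "e \<subseteq> F"
    by auto
  have "closed_nbhd n C e \<subseteq> F"
    using F \<open>e \<subseteq> F\<close> by (auto simp: closed_nbhd_def)
  moreover have "F \<subseteq> {1..n}" "card F = d + 1"
    using C \<open>F \<in> C\<close> by (auto simp: clutter_def)
  moreover have "finite F"
    using \<open>F \<subseteq> {1..n}\<close> finite_subset by blast
  moreover have "F' = F" if "F' \<subseteq> F" "card F' = d + 1" for F'
    using that \<open>card F = d + 1\<close> \<open>finite F\<close> card_subset_eq by metis
  ultimately have "clique n d C (closed_nbhd n C e)"
    using \<open>F \<in> C\<close> unfolding clique_def by blast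
  then show ?thesis
    using ms by (simp add: simplicial_def)
qed

lemma chordal_step:
  assumes "simplicial n d C e" "chordal n d (deletion C e)"
  shows "chordal n d C"
proof -
  \<comment> \<open>If \<open>deletion C e\<close> is already empty, \<open>es = []\<close>
    serves.\<close>
  obtain es where es: "\<forall>i<length es. simplicial n d (foldl deletion (deletion C e) (take i es)) (es ! i)"
      "foldl deletion (deletion C e) es = {}"
    using assms(2) unfolding chordal_def
    by (metis foldl_Nil length_0_conv less_nat_zero_code)
  have "\<forall>i<length (e # es). simplicial n d (foldl deletion C (take i (e # es))) ((e # es) ! i)"
    using assms(1) es(1) by (auto simp: nth_Cons take_Cons split: nat.split)
  moreover have "foldl deletion C (e # es) = {}"
    using es(2) by simp
  ultimately show ?thesis
    unfolding chordal_def by blast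
qed

text \<open>Cut edges \<open>xy\<close> and \<open>x'y'\<close> are joined through the cut edge
  \<open>xy'\<close>, which meets both. Two edges with a common vertex cover at most three points,
  so their complements share a \<open>d\<close>-set.\<close>

lemma cut_strongly_connected:
  fixes A V :: "nat set"
  assumes C: "clutter n d C" and V: "finite V" "card V = d + 3" and A: "A \<subseteq> V"
    and C_eq: "C = {V - {x, y} |x y. x \<in> A \<and> y \<in> V - A}"
  shows "strongly_connected n d C"
  unfolding strongly_connected_def
proof (intro ballI)
  have adj: "\<exists>e\<in>max_subcircuits n d C. e \<subseteq> F \<and> e \<subseteq> F'"
    if "F \<in> C" "V - {x, y, z} \<subseteq> F \<inter> F'" for F F' x y z
  proof -
    \<comment> \<open>The three points may coincide, so the remaining set can have more than
      \<open>d\<close> elements.\<close>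
    have "d \<le> card (V - {x, y, z})"
      using V diff_card_le_card_Diff[of "{x, y, z}" V] card_insert_le_m1[of 3 "{y, z}" x]
        card_insert_le_m1[of 2 "{z}" y] by simp
    then obtain e where "e \<subseteq> V - {x, y, z}" "card e = d"
      by (meson obtain_subset_with_card_n)
    then show ?thesis
      using that unfolding max_subcircuits_eq[OF C] by blast
  qed
  fix F1 F2 assume "F1 \<in> C" "F2 \<in> C"
  then obtain x y x' y' where x: "x \<in> A" "x' \<in> A" and y: "y \<in> V - A" "y' \<in> V - A"
    and F: "F1 = V - {x, y}" "F2 = V - {x', y'}"
    unfolding C_eq by blast
  define G where "G = V - {x, y'}"
  have "G \<in> C"
    using x y unfolding C_eq G_def by blast
  have "\<exists>e\<in>max_subcircuits n d C. e \<subseteq> F1 \<and> e \<subseteq> G"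
    by (rule adj[OF \<open>F1 \<in> C\<close>, of x y y']) (auto simp: F G_def)
  moreover have "\<exists>e\<in>max_subcircuits n d C. e \<subseteq> G \<and> e \<subseteq> F2"
    by (rule adj[OF \<open>G \<in> C\<close>, of x x' y']) (auto simp: F G_def)
  ultimately show "\<exists>Fs. Fs \<noteq> [] \<and> set Fs \<subseteq> C \<and> hd Fs = F1 \<and> last Fs = F2 \<and>
      (\<forall>i. Suc i < length Fs \<longrightarrow>
         (\<exists>e\<in>max_subcircuits n d C. e \<subseteq> Fs ! i \<and> e \<subseteq> Fs ! Suc i))"
    using \<open>F1 \<in> C\<close> \<open>F2 \<in> C\<close> \<open>G \<in> C\<close>
    by (intro exI[of _ "[F1, G, F2]"]) (auto simp: less_Suc_eq)
qed

lemma cut_deg_even: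
  fixes A V :: "nat set"
  assumes V: "finite V" "card V = d + 3" and A: "A \<subseteq> V" and e: "e \<subseteq> V" "card e = d"
  shows "even (deg {V - {x, y} |x y. x \<in> A \<and> y \<in> V - A} e)"
proof -
  define T where "T = V - e"
  have T: "finite T" "card T = 3"
    using V e finite_subset[of e V] by (auto simp: T_def card_Diff_subset)
  let ?f = "\<lambda>(x, y). V - {x, y}"
  have "{F \<in> {V - {x, y} |x y. x \<in> A \<and> y \<in> V - A}. e \<subseteq> F} = ?f ` ((T \<inter> A) \<times> (T - A))"
    using A e unfolding T_def by (auto simp: image_iff)
  moreover have "inj_on ?f ((T \<inter> A) \<times> (T - A))"
  proof (rule inj_onI, clarify)
    fix x y x' y'
    assume *: "x \<in> T" "x \<in> A" "y \<in> T" "y \<notin> A" "x' \<in> T" "x' \<in> A" "y' \<in> T" "y' \<notin> A"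
      and eq: "V - {x, y} = V - {x', y'}"
    \<comment> \<open>Membership in \<open>A\<close> then tells the two ends of the pair
      apart.\<close>
    have "{x, y} = {x', y'}"
      using * eq unfolding T_def by blast
    then show "x = x' \<and> y = y'"
      using * by (auto simp: doubleton_eq_iff)
  qed
  ultimately have deg: "deg {V - {x, y} |x y. x \<in> A \<and> y \<in> V - A} e = card (T \<inter> A) * card (T - A)"
    by (simp add: deg_def card_image card_cartesian_product)
  \<comment> \<open>An odd sum forces one of the two factors of the degree to be even.\<close>
  have "card (T \<inter> A) + card (T - A) = 3"
    using T card_Int_Diff[of T A] by simp
  then have "odd (card (T \<inter> A) + card (T - A))"
    by simp
  then show ?thesis
    unfolding deg by auto
qed

lemma CF_cycle_cut:
  fixes A V :: "nat set"
  assumes C: "clutter n d C" and V: "finite V" "card V = d + 3" and A: "A \<subseteq> V" "A \<noteq> {}" "A \<noteq> V"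
    and C_eq: "C = {V - {x, y} |x y. x \<in> A \<and> y \<in> V - A}"
  shows "CF_cycle n d C"
proof -
  have "even (deg C e)" if "e \<in> max_subcircuits n d C" for e
  proof -
    have "e \<subseteq> V" "card e = d"
      using that unfolding max_subcircuits_eq[OF C] by (auto simp: C_eq)
    then show ?thesis
      unfolding C_eq by (rule cut_deg_even[OF V A(1)])
  qed
  moreover have "C \<noteq> {}"
    using A unfolding C_eq by blast
  ultimately show ?thesis
    using C cut_strongly_connected[OF C V A(1) C_eq] by (simp add: CF_cycle_def)
qed

lemma CF_tree_has_free:
  assumes n: "n \<le> d + 3" and tree: "CF_tree n d C"
  shows "\<exists>e. free_max_subcircuit n d C e"
proof (rule ccontr)
  assume no_free: "\<not> ?thesis"
  have C: "clutter n d C" and "C \<noteq> {}"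
    using tree by (auto simp: CF_tree_def)
  define V where "V = {1..d + 3}"
  have V: "finite V" "card V = d + 3"
    by (auto simp: V_def)
  have sub: "F \<subseteq> V" "card F = d + 1" if "F \<in> C" for F
    using C that n unfolding clutter_def V_def by (fastforce, blast)
  \<comment> \<open>Transitivity of non-adjacency in contrapositive form: if \<open>zy\<close> were
    the only edge in the triple \<open>xyz\<close>, the complement of the triple would be
    free.\<close>
  have closed: "V - {x, y} \<in> C"
    if xyz: "x \<in> V" "y \<in> V" "z \<in> V" "x \<noteq> y" "x \<noteq> z" "y \<noteq> z"
      and in_C: "V - {z, y} \<in> C" and not_C: "V - {x, z} \<notin> C" for x y z
  proof (rule ccontr)
    assume "V - {x, y} \<notin> C"
    define e where "e = V - {x, y, z}"
    have "card e = d"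
      using V xyz by (simp add: e_def card_Diff_subset)
    have "F = V - {z, y}" if F: "F \<in> C" "e \<subseteq> F" for F
    proof -
      have "card (V - F) = 2"
        using V sub[OF F(1)] finite_subset[of F V] by (simp add: card_Diff_subset)
      then obtain u v where uv: "V - F = {u, v}" "u \<noteq> v"
        by (auto simp: card_2_iff)
      \<comment> \<open>The complement of \<open>F\<close> is one of the three pairs in the triple,
        and two of these are non-edges.\<close>
      then have "F = V - {u, v}" "{u, v} \<subseteq> {x, y, z}"
        using sub(1)[OF F(1)] F(2) unfolding e_def by blast+
      moreover have "V - {x, y} \<noteq> F" "V - {x, z} \<noteq> F"
        using F(1) \<open>V - {x, y} \<notin> C\<close> not_C by auto
      ultimately show ?thesis
        using uv(2) by (auto simp: insert_commute)
    qed
    moreover have "e \<subseteq> V - {z, y}"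
      by (auto simp: e_def)
    ultimately have "{F \<in> C. e \<subseteq> F} = {V - {z, y}}"
      using in_C by blast
    then have "deg C e = 1"
      by (simp add: deg_def)
    moreover have "e \<in> max_subcircuits n d C"
      using \<open>card e = d\<close> \<open>e \<subseteq> V - {z, y}\<close> in_C unfolding max_subcircuits_eq[OF C] by blast
    ultimately show False
      using no_free by (auto simp: free_max_subcircuit_def)
  qed
  obtain F where F: "F \<in> C"
    using \<open>C \<noteq> {}\<close> by blast
  have "card (V - F) = 2"
    using V sub[OF F] finite_subset[of F V] by (simp add: card_Diff_subset)
  then obtain a b where ab: "V - F = {a, b}" "a \<noteq> b"
    by (auto simp: card_2_iff)
  then have F_eq: "F = V - {a, b}" and "a \<in> V" "b \<in> V"
    using sub(1)[OF F] by blast+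
  \<comment> \<open>The non-adjacency class of \<open>a\<close>; it omits \<open>b\<close> because
    \<open>ab\<close> is an edge.\<close>
  define A where "A = {x \<in> V. x = a \<or> V - {x, a} \<notin> C}"
  have "a \<in> A" "b \<notin> A" "A \<subseteq> V"
    using F F_eq ab \<open>a \<in> V\<close> by (auto simp: A_def insert_commute)
  define D where "D = {V - {x, y} |x y. x \<in> A \<and> y \<in> V - A}"
  have "D \<subseteq> C"
  proof
    fix G assume "G \<in> D"
    then obtain x y where G: "G = V - {x, y}" and x: "x \<in> A" and y: "y \<in> V" "y \<notin> A"
      unfolding D_def by blast
    have "V - {a, y} \<in> C" "y \<noteq> a"
      using y by (auto simp: A_def insert_commute)
    then show "G \<in> C"
      \<comment> \<open>For \<open>x = a\<close> the edge is already given. Otherwise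
        \<open>xa\<close> is a non-edge and \<open>ay\<close> an edge, so \<open>xy\<close> is an
        edge.\<close>
      using closed[of x y a] x y \<open>a \<in> V\<close> unfolding G A_def by blast
  qed
  then have "CF_cycle n d D"
    using CF_cycle_cut[OF clutter_mono[OF C \<open>D \<subseteq> C\<close>] V \<open>A \<subseteq> V\<close> _ _ D_def]
      \<open>a \<in> A\<close> \<open>b \<notin> A\<close> \<open>b \<in> V\<close> by blast
  then show False
    using tree \<open>D \<subseteq> C\<close> by (auto simp: CF_tree_def)
qed

lemma CF_tree_chordal:
  assumes "n \<le> d + 3" "CF_tree n d C"
  shows "chordal n d C"
  using assms(2)
proof (induction "card C" arbitrary: C rule: less_induct)
  case less
  have C: "clutter n d C"
    using less.prems by (simp add: CF_tree_def)
  obtain e where e: "free_max_subcircuit n d C e"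
    using CF_tree_has_free[OF assms(1) less.prems] by blast
  have "deletion C e \<subset> C"
    using e by (auto simp: free_max_subcircuit_def max_subcircuits_def deletion_def)
  \<comment> \<open>The deletion is either empty, hence chordal by definition, or a CF-tree with
    fewer circuits.\<close>
  then have "chordal n d (deletion C e)"
    using less.hyps less.prems CF_tree_mono psubset_card_mono[OF finite_clutter[OF C]]
    by (metis chordal_def psubset_imp_subset)
  then show ?case
    using chordal_step free_imp_simplicial[OF C e] by blast
qed

theorem corollary3p8:
  fixes n d :: nat
  assumes "n \<le> d + 3"
  shows "\<forall>C. CF_tree n d C \<longrightarrow> (\<exists>e. free_max_subcircuit n d C e) \<and> chordal n d C"
  using CF_tree_has_free[OF assms] CF_tree_chordal[OF assms] by blast

end
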